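(* Let $N \in \mathbb{R}^{n\times m}$ with $n\le m$, let $r \in \{1,\dots,n\}$, and define $f:\mathbb{R}^{n\times m}\to\mathbb{R}\cup\{\infty\}$ by $$f(M) := \tfrac12\|N-M\|_F^2 + \chi_{\mathrm{rank}(M)\le r}(M).$$ Then the conjugate and bi-conjugate functions of $f$ are given, for all $D, M\in\mathbb{R}^{n\times m}$, by $$f^{\ast}(D) = \tfrac12\|N+D\|_r^2 - \tfrac12\|N\|_F^2,$$ $$f^{\ast\ast}(M) = \tfrac12\|M\|_{r\ast}^2 - \langle N,M\rangle + \tfrac12\|N\|_F^2 .$$
   Context: Matrices are real, $n\times m$ with $n\le m$; $\sigma_1(X)\ge\dots\ge\sigma_n(X)\ge 0$ are the singular values of $X\in\mathbb{R}^{n\times m}$ counted with multiplicity. $\langle X,Y\rangle=\mathrm{trace}(X^{\mathsf T}Y)$ is the Frobenius inner product and $\|\cdot\|_F$ the Frobenius norm. For $r\in\{1,\dots,n\}$, $\|M\|_r:=\sqrt{\sum_{i=1}^r\sigma_i^2(M)}$, and $\|M\|_{r\ast}:=\max_{\|X\|_r\le1}\langle M,X\rangle$ is its dual norm. $\chi_{\mathrm{rank}(M)\le r}(M)$ equals $0$ if $\mathrm{rank}(M)\le r$ and $\infty$ otherwise. The conjugate of $f$ is $f^\ast(D):=\sup_{M\in\mathbb{R}^{n\times m}}[\langle D,M\rangle-f(M)]$ and the bi-conjugate is $f^{\ast\ast}:=(f^\ast)^\ast$. *)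

theory Defs
  imports "HOL-Analysis.Analysis"
begin

text \<open>
  An \<open>n \<times> m\<close> matrix is an element of \<^typ>\<open>real^'m^'n\<close>. On this type the library's
  \<open>\<bullet>\<close> and \<open>norm\<close> are the Frobenius inner product and the Frobenius norm.
\<close>

lemma inner_eq_trace:
  fixes X Y :: "real^'m^'n"
  shows "X \<bullet> Y = trace (transpose X ** Y)"
proof -
  have "X \<bullet> Y = (\<Sum>i\<in>UNIV. \<Sum>j\<in>UNIV. X $ i $ j * Y $ i $ j)"
    by (simp add: inner_vec_def)
  also have "\<dots> = (\<Sum>j\<in>UNIV. \<Sum>i\<in>UNIV. X $ i $ j * Y $ i $ j)"
    by (rule sum.swap)
  also have "\<dots> = trace (transpose X ** Y)"
    by (simp add: trace_def matrix_matrix_mult_def transpose_def)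
  finally show ?thesis .
qed

lemma norm_eq_sqrt_trace:
  fixes X :: "real^'m^'n"
  shows "norm X = sqrt (trace (transpose X ** X))"
  by (simp add: norm_eq_sqrt_inner inner_eq_trace)

definition sv_space :: "real^'m^'n \<Rightarrow> real \<Rightarrow> (real^'n) set" where
  "sv_space X s = {u. (X ** transpose X) *v u = s\<^sup>2 *\<^sub>R u}"

text \<open>
  The singular values are the nonnegative square roots of the eigenvalues of the symmetric
  matrix \<open>X X\<^sup>T\<close>; each is repeated according to the dimension of the eigenspace, and the
  list is in nonincreasing order. As \<open>X X\<^sup>T\<close> is \<open>n \<times> n\<close> and diagonalizable, the list has
  length \<open>n\<close>; for \<open>n \<le> m\<close> these are the usual \<open>min n m\<close> singular values.
\<close>

definition singular_values :: "real^'m^'n \<Rightarrow> real list" where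
  "singular_values X =
     concat (map (\<lambda>s. replicate (dim (sv_space X s)) s)
       (rev (sorted_list_of_set {s. 0 \<le> s \<and> (\<exists>u\<in>sv_space X s. u \<noteq> 0)})))"

text \<open>Singular values are indexed from \<open>1\<close>.\<close>

definition sing_val :: "nat \<Rightarrow> real^'m^'n \<Rightarrow> real" where
  "sing_val i X = singular_values X ! (i - 1)"

definition r_norm :: "nat \<Rightarrow> real^'m^'n \<Rightarrow> real" where
  "r_norm r M = sqrt (\<Sum>i=1..r. (sing_val i M)\<^sup>2)"

definition r_dual_norm :: "nat \<Rightarrow> real^'m^'n \<Rightarrow> real" where
  "r_dual_norm r M = (GREATEST c. \<exists>X. r_norm r X \<le> 1 \<and> c = M \<bullet> X)"

definition chi_rank_le :: "nat \<Rightarrow> real^'m^'n \<Rightarrow> ereal" where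
  "chi_rank_le r M = (if rank M \<le> r then 0 else \<infinity>)"

definition conjugate :: "('a::real_inner \<Rightarrow> ereal) \<Rightarrow> 'a \<Rightarrow> ereal" where
  "conjugate f D = (SUP M. ereal (D \<bullet> M) - f M)"

end

theory Submission imports Defs begin

text \<open>
  Completing the square in \<open>D \<bullet> M - \<parallel>N - M\<parallel>\<^sup>2 / 2\<close> turns the first claim into a statement about
  the single matrix \<open>A = N + D\<close>: the maximum of \<open>A \<bullet> M - \<parallel>M\<parallel>\<^sup>2 / 2\<close> over \<open>rank M \<le> r\<close> is half
  the sum of the \<open>r\<close> largest squared singular values of \<open>A\<close>. This is a form of the
  Eckart--Young theorem. For the upper bound, let \<open>E\<close> be an orthonormal basis of the column
  space of \<open>M\<close>, so that \<open>E\<close> has at most \<open>r\<close> elements. Both \<open>A \<bullet> M\<close> and \<open>\<parallel>M\<parallel>\<^sup>2\<close> are sums over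
  \<open>e \<in> E\<close> of inner products of \<open>A\<^sup>T e\<close> and \<open>M\<^sup>T e\<close> (\<open>inner_as_sum_over_column_basis\<close>), and
  each summand is at most \<open>\<parallel>A\<^sup>T e\<parallel>\<^sup>2 / 2\<close>. By Ky Fan's maximum principle
  (\<open>sum_orthonormal_le_r_norm\<close>), the sum of \<open>\<parallel>A\<^sup>T e\<parallel>\<^sup>2\<close> over at most \<open>r\<close> orthonormal vectors does
  not exceed the sum of the \<open>r\<close> largest eigenvalues of \<open>A A\<^sup>T\<close>. Equality holds for the
  orthogonal projection of \<open>A\<close> onto \<open>r\<close> top eigenvectors (\<open>low_rank_value_attained\<close>).

  All of this needs an orthonormal eigenbasis of \<open>A A\<^sup>T\<close> whose \<open>i\<close>-th vector belongs to the
  \<open>i\<close>-th entry of the list of singular values (\<open>singular_basis\<close>). It comes from concatenating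
  orthonormal bases of the eigenspaces in the order of the list; that the result spans the
  whole space is the spectral theorem, proved by maximizing the quadratic form on the
  orthogonal complement.

  The maximum formula also gives \<open>X \<bullet> M \<le> c \<parallel>M\<parallel>\<close> for all \<open>M\<close> of rank at most \<open>r\<close> as a
  description of \<open>r_norm r X \<le> c\<close> (\<open>r_norm_le_iff\<close>). From this description one reads off that
  the r-norm is homogeneous and that its unit ball is compact. Hence the dual norm \<open>c\<close> of \<open>M\<close> is attained
  at some \<open>X\<close>, and it satisfies the Hoelder inequality \<open>M \<bullet> Y \<le> c * r_norm r Y\<close>. After the
  translation \<open>Y = N + D\<close>, the bi-conjugate is the supremum of \<open>M \<bullet> Y - (r_norm r Y)\<^sup>2 / 2\<close> up to
  the terms in \<open>N\<close>. It is at most \<open>c\<^sup>2 / 2\<close> because \<open>c y - y\<^sup>2 / 2 \<le> c\<^sup>2 / 2\<close>, with equality at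
  \<open>Y = c X\<close>.
\<close>

section \<open>Orthonormal sets\<close>

definition orthonormal :: "'a::euclidean_space set \<Rightarrow> bool" where
  "orthonormal E \<longleftrightarrow> pairwise orthogonal E \<and> (\<forall>e\<in>E. norm e = 1)"

lemma orthonormal_inner:
  assumes "orthonormal E" "a \<in> E" "b \<in> E"
  shows "a \<bullet> b = (if a = b then 1 else 0)"
  using assms by (auto simp: orthonormal_def pairwise_def orthogonal_def norm_eq_1)

lemma orthonormal_independent:
  assumes "orthonormal E"
  shows "independent E" "finite E"
proof -
  show "independent E"
    using assms by (intro pairwise_orthogonal_independent) (auto simp: orthonormal_def)
  then show "finite E"
    by (rule independent_imp_finite)
qed

lemma obtain_orthonormal_basis:
  fixes S :: "'a::euclidean_space set"
  assumes "subspace S"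
  obtains B where "orthonormal B" "card B = dim S" "span B = S"
  using orthonormal_basis_subspace[OF assms] unfolding orthonormal_def by metis

text \<open>
  The difference of the two sides lies in the span of \<open>E\<close> and, by the Gram--Schmidt step, is
  orthogonal to it, hence is orthogonal to itself.
\<close>

lemma orthonormal_expansion:
  assumes "orthonormal E" "x \<in> span E"
  shows "(\<Sum>e\<in>E. (e \<bullet> x) *\<^sub>R e) = x"
proof -
  let ?y = "x - (\<Sum>e\<in>E. (e \<bullet> x) *\<^sub>R e)"
  have "orthogonal v ?y" if "v \<in> span E" for v
    using Gram_Schmidt_step[of E v x] assms that orthonormal_independent(2)[OF assms(1)]
    by (simp add: orthonormal_def dot_square_norm)
  moreover have "?y \<in> span E"
    using assms by (intro span_diff span_sum span_scale) (auto intro: span_base)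
  ultimately have "?y = 0"
    using orthogonal_self by blast
  then show ?thesis
    by simp
qed

lemma orthonormal_parseval:
  assumes "orthonormal E" "x \<in> span E"
  shows "(\<Sum>e\<in>E. (e \<bullet> x) * (e \<bullet> y)) = x \<bullet> y"
proof -
  have "x \<bullet> y = (\<Sum>e\<in>E. (e \<bullet> x) *\<^sub>R e) \<bullet> y"
    using orthonormal_expansion[OF assms] by simp
  then show ?thesis
    by (simp add: inner_sum_left)
qed

text \<open>
  With \<open>p\<close> the projection of \<open>x\<close> to the span of \<open>E\<close>, this is \<open>\<parallel>x - p\<parallel>\<^sup>2 \<ge> 0\<close> expanded.
\<close>

lemma orthonormal_bessel:
  assumes "orthonormal E"
  shows "(\<Sum>e\<in>E. (e \<bullet> x)\<^sup>2) \<le> x \<bullet> x"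
proof -
  define p where "p = (\<Sum>e\<in>E. (e \<bullet> x) *\<^sub>R e)"
  have p: "p \<in> span E"
    unfolding p_def by (intro span_sum span_scale span_base)
  have ep: "e \<bullet> p = e \<bullet> x" if "e \<in> E" for e
  proof -
    have "e \<bullet> p = (\<Sum>a\<in>E. if a = e then e \<bullet> x else 0)"
      unfolding p_def inner_sum_right
      by (rule sum.cong) (use that orthonormal_inner[OF assms] in auto)
    then show ?thesis
      using that orthonormal_independent(2)[OF assms] by simp
  qed
  have pp: "p \<bullet> p = (\<Sum>e\<in>E. (e \<bullet> x)\<^sup>2)" and px: "p \<bullet> x = (\<Sum>e\<in>E. (e \<bullet> x)\<^sup>2)"
    using orthonormal_parseval[OF assms p, of p] orthonormal_parseval[OF assms p, of x] ep
    by (simp_all add: power2_eq_square)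
  have "0 \<le> (x - p) \<bullet> (x - p)"
    by simp
  also have "\<dots> = x \<bullet> x - (\<Sum>e\<in>E. (e \<bullet> x)\<^sup>2)"
    using pp px by (simp add: inner_diff inner_commute)
  finally show ?thesis
    by simp
qed


section \<open>An orthonormal basis matching the list of singular values\<close>

text \<open>
  All facts about \<open>X X\<^sup>T\<close> that matter, namely that it is symmetric and positive semidefinite,
  are instances of this identity; here \<open>u v* X\<close> is \<open>X\<^sup>T u\<close>.
\<close>

lemma inner_gram:
  fixes X :: "real^'m^'n"
  shows "((X ** transpose X) *v u) \<bullet> v = (u v* X) \<bullet> (v v* X)"
  by (metis dot_lmul_matrix inner_commute matrix_vector_mul_assoc transpose_matrix_vector)

lemma subspace_sv_space: "subspace (sv_space X s)"
  unfolding sv_space_def subspace_def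
  by (auto simp: matrix_vector_right_distrib matrix_vector_mult_scaleR algebra_simps)

lemma sv_space_orthogonal:
  fixes X :: "real^'m^'n"
  assumes "u \<in> sv_space X s" "v \<in> sv_space X t" "0 \<le> s" "0 \<le> t" "s \<noteq> t"
  shows "u \<bullet> v = 0"
proof -
  have "s\<^sup>2 * (u \<bullet> v) = t\<^sup>2 * (u \<bullet> v)"
    using inner_gram[of X u v] inner_gram[of X v u] assms(1,2)
    by (simp add: sv_space_def inner_commute)
  moreover have "s\<^sup>2 \<noteq> t\<^sup>2"
    using assms by simp
  ultimately show ?thesis
    by simp
qed

text \<open>
  The induction step of the spectral theorem. A maximizer \<open>v\<close> of the quadratic form on the unit
  sphere of the invariant subspace is an eigenvector, and the maximum \<open>l\<close> is its
  eigenvalue: the form \<open>l \<parallel>w\<parallel>\<^sup>2 - w \<bullet> G w\<close> is nonnegative on the subspace and vanishes at \<open>v\<close>, so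
  its derivative at \<open>v\<close> vanishes in every direction, in particular in the direction
  \<open>l v - G v\<close>, which invariance puts into the subspace.
\<close>

lemma exists_sv_in_invariant_subspace:
  fixes X :: "real^'m^'n"
  assumes W: "subspace W" "W \<noteq> {0}"
    and inv: "\<And>w. w \<in> W \<Longrightarrow> (X ** transpose X) *v w \<in> W"
  obtains s v where "0 \<le> s" "v \<in> W" "v \<noteq> 0" "v \<in> sv_space X s"
proof -
  define G where "G = X ** transpose X"
  define K where "K = W \<inter> sphere 0 1"
  obtain w0 where w0: "w0 \<in> W" "w0 \<noteq> 0"
    using W subspace_0 by blast
  have "w0 /\<^sub>R norm w0 \<in> K"
    using w0 W by (simp add: K_def subspace_scale)
  moreover have "compact K"
    unfolding K_def using W closed_subspace by (intro closed_Int_compact) auto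
  moreover have "continuous_on K (\<lambda>v. v \<bullet> (G *v v))"
    by (intro continuous_intros linear_continuous_on matrix_vector_mul_bounded_linear)
  ultimately obtain v where v: "v \<in> K" and max: "\<And>w. w \<in> K \<Longrightarrow> w \<bullet> (G *v w) \<le> v \<bullet> (G *v v)"
    using continuous_attains_sup[of K] by blast
  define l where "l = v \<bullet> (G *v v)"
  have vW: "v \<in> W" and nv: "v \<bullet> v = 1"
    using v by (auto simp: K_def norm_eq_1)
  have sym: "(G *v a) \<bullet> b = a \<bullet> (G *v b)" for a b
    unfolding G_def using inner_gram[of X a b] inner_gram[of X b a] by (simp add: inner_commute)
  have q: "0 \<le> l * (w \<bullet> w) - w \<bullet> (G *v w)" if "w \<in> W" for w
  proof (cases "w = 0")
    case False
    have "w /\<^sub>R norm w \<in> K"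
      using False that W by (simp add: K_def subspace_scale)
    from max[OF this] have "(w \<bullet> (G *v w)) / (norm w)\<^sup>2 \<le> l"
      by (simp add: l_def matrix_vector_mult_scaleR power2_eq_square field_simps)
    then show ?thesis
      using False by (simp add: field_simps dot_square_norm)
  qed simp
  define w where "w = l *\<^sub>R v - G *v v"
  have wW: "w \<in> W"
    unfolding w_def G_def using W vW inv by (intro subspace_diff subspace_scale) auto
  define c where "c = w \<bullet> w"
  define d where "d = l * (w \<bullet> w) - w \<bullet> (G *v w)"
  \<comment> \<open>Along \<open>v + t w\<close> the nonnegative form equals \<open>2 t c + t\<^sup>2 d\<close>. The chosen \<open>t\<close> would make this
     negative if \<open>c > 0\<close>; adding 1 in the denominator allows \<open>d = 0\<close>.\<close>
  have d0: "0 \<le> d" using q[OF wW] by (simp add: d_def)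
  define t where "t = - c / (d + 1)"
  have "0 \<le> l * ((v + t *\<^sub>R w) \<bullet> (v + t *\<^sub>R w)) - (v + t *\<^sub>R w) \<bullet> (G *v (v + t *\<^sub>R w))"
    using q W vW wW by (simp add: subspace_add subspace_scale)
  also have "\<dots> = 2 * t * (l * (v \<bullet> w) - (G *v v) \<bullet> w) + t\<^sup>2 * d"
    using sym[of v w] nv
    by (simp add: d_def l_def matrix_vector_mult_scaleR matrix_vector_right_distrib
        inner_add inner_commute power2_eq_square algebra_simps)
  also have "l * (v \<bullet> w) - (G *v v) \<bullet> w = c"
    by (simp add: c_def w_def inner_diff algebra_simps)
  finally have "0 \<le> 2 * t * c + t\<^sup>2 * d" .
  then have "0 \<le> (2 * t * c + t\<^sup>2 * d) * (d + 1)\<^sup>2"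
    by simp
  also have "\<dots> = 2 * (t * (d + 1)) * c * (d + 1) + (t * (d + 1))\<^sup>2 * d"
    by (simp add: power2_eq_square algebra_simps)
  also have "t * (d + 1) = - c"
    using d0 by (simp add: t_def)
  finally have "c\<^sup>2 * (d + 2) \<le> 0"
    by (simp add: power2_eq_square algebra_simps)
  then have "c = 0"
    using d0 by (simp add: mult_le_0_iff)
  then have "G *v v = l *\<^sub>R v"
    by (simp add: c_def w_def)
  moreover have "0 \<le> l"
    using inner_gram[of X v v] by (simp add: l_def G_def inner_commute)
  ultimately have "v \<in> sv_space X (sqrt l)"
    by (simp add: sv_space_def G_def)
  moreover have "v \<noteq> 0" using nv by auto
  ultimately show ?thesis
    using that[of "sqrt l" v] vW \<open>0 \<le> l\<close> by simp
qed

text \<open>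
  Needed because \<open>sorted_list_of_set\<close> is the empty list on an infinite set. Eigenvectors chosen
  for distinct values are orthogonal, hence independent, so there are only finitely many.
\<close>

lemma finite_singular_values:
  fixes X :: "real^'m^'n"
  shows "finite {s. 0 \<le> s \<and> (\<exists>u\<in>sv_space X s. u \<noteq> 0)}" (is "finite ?S")
proof -
  define w where "w s = (SOME u. u \<in> sv_space X s \<and> u \<noteq> 0)" for s
  have w: "w s \<in> sv_space X s \<and> w s \<noteq> 0" if "s \<in> ?S" for s
    unfolding w_def by (rule someI_ex) (use that in blast)
  have orth: "w s \<bullet> w t = 0" if "s \<in> ?S" "t \<in> ?S" "s \<noteq> t" for s t
    using w[OF that(1)] w[OF that(2)] that by (intro sv_space_orthogonal[of "w s" X s "w t" t]) auto
  have inj: "inj_on w ?S"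
  proof (rule inj_onI, rule ccontr)
    fix s t assume "s \<in> ?S" "t \<in> ?S" "w s = w t" "s \<noteq> t"
    then have "w s \<bullet> w s = 0"
      using orth[of s t] by simp
    then show False
      using w[OF \<open>s \<in> ?S\<close>] by simp
  qed
  have "pairwise orthogonal (w ` ?S)"
    using orth by (fastforce simp: pairwise_def orthogonal_def)
  moreover have "0 \<notin> w ` ?S"
    using w by force
  ultimately have "finite (w ` ?S)"
    by (intro independent_imp_finite pairwise_orthogonal_independent)
  then show ?thesis
    using inj finite_imageD by blast
qed

lemma sorted_concat_replicate:
  fixes L :: "'a::linorder list"
  assumes "sorted_wrt (\<ge>) L"
  shows "sorted_wrt (\<ge>) (concat (map (\<lambda>s. replicate (d s) s) L))"
  using assms
proof (induction L)
  case (Cons a L)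
  have "sorted_wrt (\<ge>) (replicate k a)" for k
    by (induction k) auto
  then show ?case
    using Cons by (auto simp: sorted_wrt_append split: if_splits)
qed simp

lemma list_all2_concat_replicate:
  assumes "\<And>s. s \<in> set L \<Longrightarrow> length (bl s) = d s \<and> set (bl s) \<subseteq> V s"
  shows "list_all2 (\<lambda>s b. b \<in> V s) (concat (map (\<lambda>s. replicate (d s) s) L)) (concat (map bl L))"
  using assms
proof (induction L)
  case (Cons a L)
  have "list_all2 (\<lambda>s b. b \<in> V s) (replicate (d a) a) (bl a)"
    using Cons.prems[of a] by (auto simp: list_all2_conv_all_nth)
  then show ?case
    using Cons by (auto intro!: list_all2_appendI)
qed simp

text \<open>
  Indices start from \<open>1\<close>, as for \<open>sing_val\<close>. The construction follows the list of singular
  values: each block of equal entries is matched with an orthonormal basis of its eigenspace.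
  That the blocks have total length \<open>CARD('n)\<close> is not visible from the definition of the list;
  it follows once the chosen eigenvectors are known to span the space.
\<close>

lemma singular_basis:
  fixes X :: "real^'m^'n"
  obtains u :: "nat \<Rightarrow> real^'n"
  where "inj_on u {1..CARD('n)}" "orthonormal (u ` {1..CARD('n)})" "span (u ` {1..CARD('n)}) = UNIV"
    and "\<And>i. i \<in> {1..CARD('n)} \<Longrightarrow> u i \<in> sv_space X (sing_val i X)"
    and "\<And>i. i \<in> {1..CARD('n)} \<Longrightarrow> 0 \<le> sing_val i X"
    and "\<And>i j. 1 \<le> i \<Longrightarrow> i \<le> j \<Longrightarrow> j \<le> CARD('n) \<Longrightarrow> sing_val j X \<le> sing_val i X"
proof -
  define S where "S = {s. 0 \<le> s \<and> (\<exists>u\<in>sv_space X s. u \<noteq> 0)}"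
  define L where "L = rev (sorted_list_of_set S)"
  have finS: "finite S"
    unfolding S_def by (rule finite_singular_values)
  have L: "set L = S" "distinct L" "sorted_wrt (\<ge>) L"
    using finS sorted_sorted_list_of_set[of S]
    by (auto simp: L_def sorted_wrt_rev)
  have sv: "singular_values X = concat (map (\<lambda>s. replicate (dim (sv_space X s)) s) L)"
    by (simp add: singular_values_def L_def S_def)
  have "\<exists>bs. distinct bs \<and> orthonormal (set bs) \<and> length bs = dim (sv_space X s)
      \<and> span (set bs) = sv_space X s" for s
    using obtain_orthonormal_basis[OF subspace_sv_space[of X s]] orthonormal_independent(2)
    by (metis finite_distinct_list distinct_card)
  then obtain bl where bl: "\<And>s. distinct (bl s)" "\<And>s. orthonormal (set (bl s))"
      "\<And>s. length (bl s) = dim (sv_space X s)" "\<And>s. span (set (bl s)) = sv_space X s"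
    by metis
  define bs where "bs = concat (map bl L)"
  have sub: "set (bl s) \<subseteq> sv_space X s" for s
    using bl(4) span_superset by blast
  have cross: "a \<bullet> b = 0" if "s \<in> S" "t \<in> S" "s \<noteq> t" "a \<in> set (bl s)" "b \<in> set (bl t)" for s t a b
    using sv_space_orthogonal[of a X s b t] sub that by (auto simp: S_def)
  have norm1: "norm a = 1" if "a \<in> set (bl s)" for a s
    using bl(2)[of s] that by (simp add: orthonormal_def)
  have orth: "orthonormal (set bs)"
    unfolding orthonormal_def pairwise_def orthogonal_def
  proof (intro conjI ballI impI)
    fix a b assume "a \<in> set bs" "b \<in> set bs" "a \<noteq> b"
    then obtain s t where "s \<in> S" "t \<in> S" "a \<in> set (bl s)" "b \<in> set (bl t)"
      using L by (auto simp: bs_def)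
    then show "a \<bullet> b = 0"
      using cross[of s t a b] orthonormal_inner[OF bl(2), of a s b] \<open>a \<noteq> b\<close> by (cases "s = t") auto
  qed (use norm1 in \<open>auto simp: bs_def\<close>)
  have disj: "set (bl s) \<inter> set (bl t) = {}" if "s \<in> S" "t \<in> S" "s \<noteq> t" for s t
    using cross[OF that] norm1 by (metis disjoint_iff inner_eq_zero_iff norm_zero zero_neq_one)
  have nonempty: "bl s \<noteq> []" if "s \<in> S" for s
    using bl(4)[of s] that by (auto simp: S_def)
  have inj: "inj_on bl S"
    by (rule inj_onI) (metis disj nonempty inf.idem set_empty)
  have "distinct bs"
    unfolding bs_def using L bl(1) disj inj
    by (intro distinct_concat) (auto simp: distinct_map)
  \<comment> \<open>The orthogonal complement of the chosen eigenvectors is invariant under \<open>X X\<^sup>T\<close>; an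
     eigenvector in it would already lie in the span of the chosen ones.\<close>
  have spn: "span (set bs) = UNIV"
  proof (rule ccontr)
    assume ne: "span (set bs) \<noteq> UNIV"
    define W where "W = {y. \<forall>x\<in>set bs. orthogonal x y}"
    have subW: "subspace W"
      unfolding W_def by (rule subspace_orthogonal_to_vectors)
    have "dim (set bs) < DIM(real^'n)"
      using ne dim_eq_full[of "set bs"] dim_subset_UNIV[of "set bs"] by linarith
    then obtain x where x: "x \<noteq> 0" "\<And>y. y \<in> span (set bs) \<Longrightarrow> orthogonal x y"
      using orthogonal_to_subspace_exists[of "set bs"] by metis
    then have "x \<in> W"
      by (auto simp: W_def orthogonal_commute span_base)
    then have "W \<noteq> {0}"
      using x by blast
    moreover have "(X ** transpose X) *v w \<in> W" if "w \<in> W" for w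
    proof -
      have "b \<bullet> ((X ** transpose X) *v w) = 0" if "b \<in> set bs" for b
      proof -
        obtain s where "b \<in> sv_space X s"
          using \<open>b \<in> set bs\<close> sub by (auto simp: bs_def)
        then have "((X ** transpose X) *v b) \<bullet> w = s\<^sup>2 * (b \<bullet> w)"
          by (simp add: sv_space_def)
        moreover have "b \<bullet> w = 0"
          using \<open>w \<in> W\<close> that by (simp add: W_def orthogonal_def)
        ultimately show ?thesis
          using inner_gram[of X b w] inner_gram[of X w b] by (simp add: inner_commute)
      qed
      then show ?thesis
        by (simp add: W_def orthogonal_def)
    qed
    ultimately obtain s v where v: "0 \<le> s" "v \<in> W" "v \<noteq> 0" "v \<in> sv_space X s"
      using exists_sv_in_invariant_subspace[OF subW] by metis
    then have "s \<in> S"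
      by (auto simp: S_def)
    then have "sv_space X s \<subseteq> span (set bs)"
      using bl(4)[of s] L span_mono[of "set (bl s)" "set bs"] by (auto simp: bs_def)
    then have "orthogonal v v"
      using orthogonal_to_span[of v "set bs" v] v by (auto simp: W_def orthogonal_commute)
    then show False
      using v by (simp add: orthogonal_self)
  qed
  have len: "length bs = CARD('n)"
  proof -
    have "length bs = card (set bs)"
      using \<open>distinct bs\<close> by (simp add: distinct_card)
    also have "\<dots> = dim (span (set bs))"
      using orthonormal_independent(1)[OF orth] by (simp add: dim_eq_card_independent)
    finally show ?thesis
      by (simp add: spn)
  qed
  have match: "list_all2 (\<lambda>s b. b \<in> sv_space X s) (singular_values X) bs"
    unfolding sv bs_def using bl(3) sub by (intro list_all2_concat_replicate) auto
  have lensv: "length (singular_values X) = CARD('n)"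
    using list_all2_lengthD[OF match] len by simp
  have sorted: "sorted_wrt (\<ge>) (singular_values X)"
    unfolding sv using L by (intro sorted_concat_replicate)
  have pos: "0 \<le> s" if "s \<in> set (singular_values X)" for s
    using that L by (auto simp: sv S_def)
  define u where "u i = bs ! (i - 1)" for i
  have img: "u ` {1..CARD('n)} = set bs"
  proof -
    have "{1..CARD('n)} = Suc ` {..<CARD('n)}"
      by (auto simp: image_iff) (metis Suc_diff_1 Suc_le_lessD lessThan_iff less_Suc_eq_le)
    then show ?thesis
      by (auto simp: u_def image_image set_conv_nth len)
  qed
  show ?thesis
  proof (rule that[of u])
    show "inj_on u {1..CARD('n)}"
      using \<open>distinct bs\<close> len by (auto simp: inj_on_def u_def nth_eq_iff_index_eq)
    show "orthonormal (u ` {1..CARD('n)})" "span (u ` {1..CARD('n)}) = UNIV"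
      using orth spn by (simp_all only: img)
    show "u i \<in> sv_space X (sing_val i X)" if "i \<in> {1..CARD('n)}" for i
      using list_all2_nthD[OF match, of "i - 1"] that lensv by (auto simp: u_def sing_val_def)
    show "0 \<le> sing_val i X" if "i \<in> {1..CARD('n)}" for i
      using pos that lensv by (auto simp: sing_val_def)
    show "sing_val j X \<le> sing_val i X" if "1 \<le> i" "i \<le> j" "j \<le> CARD('n)" for i j
      using sorted_wrt_nth_less[OF sorted, of "i - 1" "j - 1"] that lensv
      by (cases "i = j") (auto simp: sing_val_def)
  qed
qed


section \<open>The variational formula for the r-norm\<close>

text \<open>
  Putting weight \<open>1\<close> on the \<open>r\<close> largest values is optimal when each weight is at most \<open>1\<close> and the
  total weight at most \<open>r\<close>. Subtracting the threshold \<open>a r\<close> makes this termwise: the first \<open>r\<close>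
  differences are nonnegative and the others nonpositive.
\<close>

lemma weighted_sum_le_top:
  fixes a w :: "nat \<Rightarrow> real"
  assumes r: "1 \<le> r" "r \<le> n"
    and nonneg: "0 \<le> a r"
    and dec: "\<And>i j. 1 \<le> i \<Longrightarrow> i \<le> j \<Longrightarrow> j \<le> n \<Longrightarrow> a j \<le> a i"
    and w: "\<And>i. i \<in> {1..n} \<Longrightarrow> 0 \<le> w i" "\<And>i. i \<in> {1..n} \<Longrightarrow> w i \<le> 1" "(\<Sum>i=1..n. w i) \<le> real r"
  shows "(\<Sum>i=1..n. a i * w i) \<le> (\<Sum>i=1..r. a i)"
proof -
  have "(\<Sum>i=1..n. (a i - a r) * w i) \<le> (\<Sum>i=1..n. if i \<in> {1..r} then a i - a r else 0)"
  proof (rule sum_mono)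
    fix i assume i: "i \<in> {1..n}"
    show "(a i - a r) * w i \<le> (if i \<in> {1..r} then a i - a r else 0)"
    proof (cases "i \<le> r")
      case True
      then show ?thesis
        using i r dec[of i r] w(2)[of i] mult_left_mono[of "w i" 1 "a i - a r"] by auto
    next
      case False
      then show ?thesis
        using i r dec[of r i] w(1)[of i] by (auto simp: mult_nonpos_nonneg)
    qed
  qed
  also have "\<dots> = (\<Sum>i=1..r. a i - a r)"
    using r by (intro sum.mono_neutral_cong_right) auto
  finally have "(\<Sum>i=1..n. a i * w i) \<le> (\<Sum>i=1..r. a i) - real r * a r + a r * (\<Sum>i=1..n. w i)"
    by (simp add: left_diff_distrib sum_subtractf sum_distrib_left)
  also have "\<dots> \<le> (\<Sum>i=1..r. a i)"
    using mult_left_mono[OF w(3) nonneg] by (simp add: mult.commute)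
  finally show ?thesis .
qed

lemma r_norm_nonneg: "0 \<le> r_norm r X"
  by (simp add: r_norm_def sum_nonneg)

lemma r_norm_sq: "(r_norm r X)\<^sup>2 = (\<Sum>i=1..r. (sing_val i X)\<^sup>2)"
  by (simp add: r_norm_def sum_nonneg)

text \<open>
  Ky Fan's maximum principle. In the eigenbasis \<open>u\<close> of \<open>X X\<^sup>T\<close>, the left-hand side is the sum of
  the squared singular values with weights \<open>w i = (\<Sum>e\<in>E. (e \<bullet> u i)\<^sup>2)\<close>. Bessel's inequality bounds
  each weight by \<open>1\<close>, and Parseval's identity shows that the weights add up to the size of \<open>E\<close>.
\<close>

lemma sum_orthonormal_le_r_norm:
  fixes X :: "real^'m^'n"
  assumes r: "1 \<le> r" "r \<le> CARD('n)" and E: "orthonormal E" "card E \<le> r"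
  shows "(\<Sum>e\<in>E. (norm (e v* X))\<^sup>2) \<le> (r_norm r X)\<^sup>2"
proof -
  obtain u :: "nat \<Rightarrow> real^'n" where inj: "inj_on u {1..CARD('n)}"
    and on: "orthonormal (u ` {1..CARD('n)})" and sp: "span (u ` {1..CARD('n)}) = UNIV"
    and ev: "\<And>i. i \<in> {1..CARD('n)} \<Longrightarrow> u i \<in> sv_space X (sing_val i X)"
    and pos: "\<And>i. i \<in> {1..CARD('n)} \<Longrightarrow> 0 \<le> sing_val i X"
    and dec: "\<And>i j. 1 \<le> i \<Longrightarrow> i \<le> j \<Longrightarrow> j \<le> CARD('n) \<Longrightarrow> sing_val j X \<le> sing_val i X"
    using singular_basis[of X] by metis
  have pars: "(\<Sum>i=1..CARD('n). (u i \<bullet> x) * (u i \<bullet> y)) = x \<bullet> y" for x y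
    using orthonormal_parseval[OF on, of x y] sp unfolding sum.reindex[OF inj] by simp
  define w where "w i = (\<Sum>e\<in>E. (e \<bullet> u i)\<^sup>2)" for i
  have "(norm (e v* X))\<^sup>2 = (\<Sum>i=1..CARD('n). (sing_val i X)\<^sup>2 * (e \<bullet> u i)\<^sup>2)" for e
  proof -
    have "(norm (e v* X))\<^sup>2 = ((X ** transpose X) *v e) \<bullet> e"
      by (simp add: inner_gram power2_norm_eq_inner)
    also have "\<dots> = (\<Sum>i=1..CARD('n). (u i \<bullet> ((X ** transpose X) *v e)) * (u i \<bullet> e))"
      by (rule pars[symmetric])
    also have "\<dots> = (\<Sum>i=1..CARD('n). (sing_val i X)\<^sup>2 * (e \<bullet> u i)\<^sup>2)"
    proof (rule sum.cong[OF refl])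
      fix i assume "i \<in> {1..CARD('n)}"
      then have "u i \<bullet> ((X ** transpose X) *v e) = (sing_val i X)\<^sup>2 * (u i \<bullet> e)"
        using inner_gram[of X "u i" e] inner_gram[of X e "u i"] ev[of i]
        by (simp add: sv_space_def inner_commute)
      then show "(u i \<bullet> ((X ** transpose X) *v e)) * (u i \<bullet> e) = (sing_val i X)\<^sup>2 * (e \<bullet> u i)\<^sup>2"
        by (simp add: power2_eq_square inner_commute)
    qed
    finally show ?thesis .
  qed
  then have "(\<Sum>e\<in>E. (norm (e v* X))\<^sup>2) = (\<Sum>i=1..CARD('n). (sing_val i X)\<^sup>2 * w i)"
    unfolding w_def sum_distrib_left by (simp add: sum.swap[of _ _ E])
  also have "\<dots> \<le> (\<Sum>i=1..r. (sing_val i X)\<^sup>2)"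
  proof (rule weighted_sum_le_top[OF r])
    show "(sing_val j X)\<^sup>2 \<le> (sing_val i X)\<^sup>2" if "1 \<le> i" "i \<le> j" "j \<le> CARD('n)" for i j
      using dec[OF that] pos[of j] that by (intro power_mono) auto
    show "0 \<le> w i" if "i \<in> {1..CARD('n)}" for i
      by (simp add: w_def sum_nonneg)
    show "w i \<le> 1" if "i \<in> {1..CARD('n)}" for i
      unfolding w_def using orthonormal_bessel[OF E(1), of "u i"] orthonormal_inner[OF on, of "u i" "u i"] that
      by simp
    have "(\<Sum>i=1..CARD('n). w i) = (\<Sum>e\<in>E. \<Sum>i=1..CARD('n). (u i \<bullet> e) * (u i \<bullet> e))"
      unfolding w_def by (subst sum.swap) (simp add: power2_eq_square inner_commute)
    also have "\<dots> = (\<Sum>e\<in>E. e \<bullet> e)"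
      by (simp only: pars)
    also have "\<dots> = real (card E)"
      using orthonormal_inner[OF E(1)] by simp
    finally show "(\<Sum>i=1..CARD('n). w i) \<le> real r"
      using E(2) by simp
  qed simp
  finally show ?thesis
    by (simp add: r_norm_sq)
qed

text \<open>
  The Frobenius product is a sum of inner products of columns, and Parseval's identity applies
  to each of them since the columns of \<open>M\<close> lie in the span of \<open>E\<close>.
\<close>

lemma inner_as_sum_over_column_basis:
  fixes A M :: "real^'m^'n"
  assumes E: "orthonormal E" "columns M \<subseteq> span E"
  shows "A \<bullet> M = (\<Sum>e\<in>E. (e v* A) \<bullet> (e v* M))"
proof -
  have "A \<bullet> M = (\<Sum>j\<in>UNIV. column j M \<bullet> column j A)"
    unfolding inner_vec_def by (subst sum.swap) (simp add: column_def mult.commute)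
  also have "\<dots> = (\<Sum>j\<in>UNIV. \<Sum>e\<in>E. (e \<bullet> column j M) * (e \<bullet> column j A))"
    using E by (intro sum.cong refl orthonormal_parseval[symmetric]) (auto simp: columns_def)
  also have "\<dots> = (\<Sum>e\<in>E. (e v* A) \<bullet> (e v* M))"
    by (subst sum.swap) (simp add: inner_vec_def vector_matrix_mult_def column_def mult.commute)
  finally show ?thesis .
qed

text \<open>
  Over an orthonormal basis of the column space of \<open>M\<close>, the left-hand side splits into terms
  bounded by \<open>\<parallel>A\<^sup>T e\<parallel>\<^sup>2 / 2\<close>, to which Ky Fan's principle applies.
\<close>

lemma low_rank_value_le:
  fixes A M :: "real^'m^'n"
  assumes r: "1 \<le> r" "r \<le> CARD('n)" and rank: "rank M \<le> r"
  shows "A \<bullet> M - 1/2 * (norm M)\<^sup>2 \<le> 1/2 * (r_norm r A)\<^sup>2"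
proof -
  obtain E where E: "orthonormal E" "card E = dim (span (columns M))" "span E = span (columns M)"
    using obtain_orthonormal_basis[OF subspace_span[of "columns M"]] by metis
  have card: "card E \<le> r"
    using E(2) rank by (simp add: column_rank_def)
  have col: "columns M \<subseteq> span E"
    using E(3) span_superset by metis
  have "A \<bullet> M - 1/2 * (norm M)\<^sup>2 = (\<Sum>e\<in>E. (e v* A) \<bullet> (e v* M) - 1/2 * (norm (e v* M))\<^sup>2)"
    using inner_as_sum_over_column_basis[OF E(1) col, of A] inner_as_sum_over_column_basis[OF E(1) col, of M]
    by (simp add: power2_norm_eq_inner sum_subtractf flip: sum_divide_distrib)
  also have "\<dots> \<le> (\<Sum>e\<in>E. 1/2 * (norm (e v* A))\<^sup>2)"
  proof (rule sum_mono)
    fix e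
    have "0 \<le> (e v* A - e v* M) \<bullet> (e v* A - e v* M)"
      by simp
    then show "(e v* A) \<bullet> (e v* M) - 1/2 * (norm (e v* M))\<^sup>2 \<le> 1/2 * (norm (e v* A))\<^sup>2"
      unfolding power2_norm_eq_inner by (simp add: inner_diff inner_commute)
  qed
  also have "\<dots> \<le> 1/2 * (r_norm r A)\<^sup>2"
    using sum_orthonormal_le_r_norm[OF r E(1) card, of A] by (simp flip: sum_divide_distrib)
  finally show ?thesis .
qed

text \<open>
  The maximizer is the truncated singular value decomposition of \<open>A\<close>, written as the matrix
  whose columns are the projections of the columns of \<open>A\<close> to the span of the first \<open>r\<close>
  eigenvectors.
\<close>

lemma low_rank_value_attained:
  fixes A :: "real^'m^'n"
  assumes r: "1 \<le> r" "r \<le> CARD('n)"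
  obtains M :: "real^'m^'n"
  where "rank M \<le> r" "A \<bullet> M = (r_norm r A)\<^sup>2" "norm M = r_norm r A"
proof -
  obtain u :: "nat \<Rightarrow> real^'n" where inj: "inj_on u {1..CARD('n)}"
    and on: "orthonormal (u ` {1..CARD('n)})"
    and ev: "\<And>i. i \<in> {1..CARD('n)} \<Longrightarrow> u i \<in> sv_space A (sing_val i A)"
    using singular_basis[of A] by metis
  define E where "E = u ` {1..r}"
  have sub: "{1..r} \<subseteq> {1..CARD('n)}"
    using r by auto
  have injr: "inj_on u {1..r}"
    using inj sub by (rule inj_on_subset)
  have E: "orthonormal E"
    using on sub unfolding orthonormal_def E_def by (meson image_mono pairwise_subset subsetD)
  have cardE: "card E = r"
    unfolding E_def card_image[OF injr] by simp
  define M :: "real^'m^'n" where "M = (\<chi> k j. \<Sum>e\<in>E. (e \<bullet> column j A) * e $ k)"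
  have colM: "column j M = (\<Sum>e\<in>E. (e \<bullet> column j A) *\<^sub>R e)" for j
    by (simp add: M_def column_def vec_eq_iff)
  have col: "columns M \<subseteq> span E"
    by (auto simp: columns_def colM intro!: span_sum span_scale intro: span_base)
  have "rank M \<le> r"
    using dim_subset[OF col] cardE orthonormal_independent[OF E] dim_eq_card_independent[of E]
    by (simp add: column_rank_def)
  have eM: "e v* M = e v* A" if "e \<in> E" for e
  proof -
    have "e \<bullet> column j M = e \<bullet> column j A" for j
    proof -
      have "e \<bullet> column j M = (\<Sum>a\<in>E. if a = e then e \<bullet> column j A else 0)"
        unfolding colM inner_sum_right
        by (rule sum.cong) (use that orthonormal_inner[OF E] in auto)
      then show ?thesis
        using that orthonormal_independent(2)[OF E] by simp
    qed
    then show ?thesis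
      by (simp add: vec_eq_iff inner_vec_def vector_matrix_mult_def column_def mult.commute)
  qed
  have val: "(\<Sum>e\<in>E. (e v* A) \<bullet> (e v* A)) = (r_norm r A)\<^sup>2"
  proof -
    have "(\<Sum>e\<in>E. (e v* A) \<bullet> (e v* A)) = (\<Sum>i=1..r. (u i v* A) \<bullet> (u i v* A))"
      unfolding E_def sum.reindex[OF injr] by simp
    also have "\<dots> = (\<Sum>i=1..r. (sing_val i A)\<^sup>2)"
    proof (rule sum.cong[OF refl])
      fix i assume "i \<in> {1..r}"
      then have "i \<in> {1..CARD('n)}" using sub by blast
      then show "(u i v* A) \<bullet> (u i v* A) = (sing_val i A)\<^sup>2"
        using ev[of i] orthonormal_inner[OF on, of "u i" "u i"] inner_gram[of A "u i" "u i"]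
        by (simp add: sv_space_def)
    qed
    finally show ?thesis
      by (simp add: r_norm_sq)
  qed
  have "A \<bullet> M = (r_norm r A)\<^sup>2"
    using inner_as_sum_over_column_basis[OF E col, of A] eM val by simp
  moreover have "(norm M)\<^sup>2 = (r_norm r A)\<^sup>2"
    using inner_as_sum_over_column_basis[OF E col, of M] eM val by (simp add: power2_norm_eq_inner)
  then have "norm M = r_norm r A"
    by (simp add: r_norm_nonneg)
  ultimately show ?thesis
    using that \<open>rank M \<le> r\<close> by blast
qed

lemma rank_scaleR_le:
  fixes M :: "real^'m^'n"
  shows "rank (c *\<^sub>R M) \<le> rank M"
proof -
  have "column j (c *\<^sub>R M) = c *\<^sub>R column j M" for j
    by (simp add: column_def vec_eq_iff)
  then have "columns (c *\<^sub>R M) \<subseteq> span (columns M)"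
    by (auto simp: columns_def intro!: span_scale intro: span_base)
  then show ?thesis
    using dim_subset[of "columns (c *\<^sub>R M)" "span (columns M)"] by (simp add: column_rank_def)
qed

lemma inner_le_r_norm:
  fixes X M :: "real^'m^'n"
  assumes r: "1 \<le> r" "r \<le> CARD('n)" and rank: "rank M \<le> r"
  shows "X \<bullet> M \<le> r_norm r X * norm M"
proof (cases "M = 0")
  case False
  \<comment> \<open>The quadratic bound is applied to the best multiple of \<open>M\<close>.\<close>
  define t where "t = X \<bullet> M / (norm M)\<^sup>2"
  have "X \<bullet> (t *\<^sub>R M) - 1/2 * (norm (t *\<^sub>R M))\<^sup>2 \<le> 1/2 * (r_norm r X)\<^sup>2"
    using rank rank_scaleR_le[of t M] by (intro low_rank_value_le[OF r]) linarith
  then have "(X \<bullet> M)\<^sup>2 \<le> (r_norm r X * norm M)\<^sup>2"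
    using False by (simp add: t_def field_simps power2_eq_square)
  then show ?thesis
    by (rule power2_le_imp_le) (simp add: r_norm_nonneg)
qed simp

text \<open>
  The r-norm is the support function of the matrices of rank at most \<open>r\<close> and norm at most \<open>1\<close>.
  In this form, homogeneity is immediate, and the balls are intersections of closed half-spaces.
\<close>

lemma r_norm_le_iff:
  fixes X :: "real^'m^'n"
  assumes r: "1 \<le> r" "r \<le> CARD('n)" and "0 \<le> c"
  shows "r_norm r X \<le> c \<longleftrightarrow> (\<forall>M. rank M \<le> r \<longrightarrow> X \<bullet> M \<le> c * norm M)"
proof (intro iffI allI impI)
  fix M :: "real^'m^'n"
  assume "r_norm r X \<le> c" "rank M \<le> r"
  then show "X \<bullet> M \<le> c * norm M"
    using inner_le_r_norm[OF r, of M X] mult_right_mono[of "r_norm r X" c "norm M"] by simp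
next
  assume *: "\<forall>M. rank M \<le> r \<longrightarrow> X \<bullet> M \<le> c * norm M"
  obtain M :: "real^'m^'n" where "rank M \<le> r" "X \<bullet> M = (r_norm r X)\<^sup>2" "norm M = r_norm r X"
    using low_rank_value_attained[OF r, of X] by metis
  with * have "r_norm r X * r_norm r X \<le> c * r_norm r X"
    by (metis power2_eq_square)
  then show "r_norm r X \<le> c"
    using r_norm_nonneg[of r X] \<open>0 \<le> c\<close> by (auto simp: mult_le_cancel_right)
qed

lemma r_norm_scaleR_le:
  fixes X :: "real^'m^'n"
  assumes r: "1 \<le> r" "r \<le> CARD('n)" and "0 \<le> t"
  shows "r_norm r (t *\<^sub>R X) \<le> t * r_norm r X"
proof -
  have "(t *\<^sub>R X) \<bullet> M \<le> t * r_norm r X * norm M" if "rank M \<le> r" for M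
    using mult_left_mono[OF inner_le_r_norm[OF r that, of X] \<open>0 \<le> t\<close>] by (simp add: mult.assoc)
  then show ?thesis
    using \<open>0 \<le> t\<close> by (simp add: r_norm_le_iff[OF r] r_norm_nonneg)
qed

text \<open>
  The matrix units have rank one and norm one, so the r-norm dominates every entry. This gives
  boundedness of the unit ball, and definiteness of the r-norm.
\<close>

lemma abs_Basis_inner_le_r_norm:
  fixes X :: "real^'m^'n"
  assumes r: "1 \<le> r" "r \<le> CARD('n)" and b: "b \<in> Basis"
  shows "\<bar>X \<bullet> b\<bar> \<le> r_norm r X"
proof -
  obtain i j where bij: "b = axis i (axis j 1)"
    using b by (auto simp: Basis_vec_def)
  have "column k b = (if k = j then axis i 1 else 0)" for k
    by (auto simp: bij column_def axis_def vec_eq_iff)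
  then have "columns b \<subseteq> span {axis i 1}"
    by (auto simp: columns_def span_base span_0)
  then have "rank b \<le> 1"
    using dim_le_card[of "columns b" "{axis i 1}"] by (simp add: column_rank_def)
  then have "rank b \<le> r" "rank (- b) \<le> r"
    using r rank_scaleR_le[of "-1" b] by auto
  then show ?thesis
    using inner_le_r_norm[OF r, of b X] inner_le_r_norm[OF r, of "- b" X] b
    by (simp add: norm_Basis)
qed

lemma compact_r_norm_ball:
  assumes r: "1 \<le> r" "r \<le> CARD('n)"
  shows "compact {X :: real^'m^'n. r_norm r X \<le> 1}" (is "compact ?B")
proof -
  have "?B = (\<Inter>M\<in>{M. rank M \<le> r}. {X. X \<bullet> M \<le> norm M})"
    by (auto simp: r_norm_le_iff[OF r])
  moreover have "closed \<dots>"
    by (intro closed_INT ballI closed_Collect_le continuous_intros)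
  ultimately have "closed ?B"
    by simp
  moreover have "bounded ?B"
    unfolding bounded_iff
  proof (intro exI ballI)
    fix X :: "real^'m^'n" assume X: "X \<in> ?B"
    have "norm X \<le> (\<Sum>b\<in>Basis. \<bar>X \<bullet> b\<bar>)"
      by (rule norm_le_l1)
    also have "\<dots> \<le> (\<Sum>b\<in>(Basis :: (real^'m^'n) set). 1)"
      using abs_Basis_inner_le_r_norm[OF r] X by (intro sum_mono) (fastforce intro: order_trans)
    finally show "norm X \<le> (\<Sum>b\<in>(Basis :: (real^'m^'n) set). 1)" .
  qed
  ultimately show ?thesis
    by (simp add: compact_eq_bounded_closed)
qed


section \<open>The dual norm\<close>

text \<open>
  Compactness of the unit ball is what gives the \<open>GREATEST\<close> in the definition of the dual norm
  its meaning.
\<close>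

lemma r_dual_norm_attained:
  fixes M :: "real^'m^'n"
  assumes r: "1 \<le> r" "r \<le> CARD('n)"
  obtains X where "r_norm r X \<le> 1" "M \<bullet> X = r_dual_norm r M"
    and "\<And>Y. r_norm r Y \<le> 1 \<Longrightarrow> M \<bullet> Y \<le> r_dual_norm r M" "0 \<le> r_dual_norm r M"
proof -
  let ?B = "{X :: real^'m^'n. r_norm r X \<le> 1}"
  have zero: "0 \<in> ?B"
    by (simp add: r_norm_le_iff[OF r])
  obtain X where X: "X \<in> ?B" and max: "\<And>Y. Y \<in> ?B \<Longrightarrow> M \<bullet> Y \<le> M \<bullet> X"
    using continuous_attains_sup[OF compact_r_norm_ball[OF r] _ continuous_on_inner[OF continuous_on_const continuous_on_id], of M] zero
    by blast
  have "r_dual_norm r M = M \<bullet> X"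
    unfolding r_dual_norm_def using X max by (intro Greatest_equality) auto
  then show ?thesis
    using that[of X] X max max[OF zero] by auto
qed

lemma inner_le_dual:
  fixes M Y :: "real^'m^'n"
  assumes r: "1 \<le> r" "r \<le> CARD('n)"
  shows "M \<bullet> Y \<le> r_dual_norm r M * r_norm r Y"
proof (cases "r_norm r Y = 0")
  case True
  then have "Y = 0"
    using abs_Basis_inner_le_r_norm[OF r, of _ Y] by (auto simp: euclidean_eq_iff[of Y])
  then show ?thesis
    using True by simp
next
  case False
  then have pos: "0 < r_norm r Y"
    using r_norm_nonneg[of r Y] by simp
  then have "r_norm r (Y /\<^sub>R r_norm r Y) \<le> 1"
    using r_norm_scaleR_le[OF r, of "inverse (r_norm r Y)" Y] by simp
  then have "M \<bullet> (Y /\<^sub>R r_norm r Y) \<le> r_dual_norm r M"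
    using r_dual_norm_attained[OF r, of M] by metis
  then show ?thesis
    using pos by (simp add: field_simps)
qed


section \<open>Conjugate and bi-conjugate\<close>

text \<open>
  Both conjugates are computed by exhibiting a maximizer.
\<close>

lemma conjugate_attained:
  assumes "\<And>x. ereal (D \<bullet> x) - f x \<le> ereal c" "ereal (D \<bullet> x0) - f x0 \<ge> ereal c"
  shows "conjugate f D = ereal c"
  unfolding conjugate_def
proof (rule antisym)
  show "(SUP x. ereal (D \<bullet> x) - f x) \<le> ereal c"
    using assms(1) by (rule SUP_least)
  show "ereal c \<le> (SUP x. ereal (D \<bullet> x) - f x)"
    using assms(2) by (rule SUP_upper2[OF UNIV_I])
qed

theorem theorem1:
  fixes N :: "real^'m^'n" and r :: nat and f :: "real^'m^'n \<Rightarrow> ereal"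
  assumes "CARD('n) \<le> CARD('m)"
    and "r \<in> {1..CARD('n)}"
    and f: "\<And>M. f M = ereal (1 / 2 * (norm (N - M))\<^sup>2) + chi_rank_le r M"
  shows "(\<forall>D. conjugate f D = ereal (1 / 2 * (r_norm r (N + D))\<^sup>2 - 1 / 2 * (norm N)\<^sup>2)) \<and>
         (\<forall>M. conjugate (conjugate f) M =
            ereal (1 / 2 * (r_dual_norm r M)\<^sup>2 - N \<bullet> M + 1 / 2 * (norm N)\<^sup>2))"
proof -
  have r: "1 \<le> r" "r \<le> CARD('n)"
    using assms(2) by auto
  \<comment> \<open>Completing the square reduces the conjugate to the best low-rank value for \<open>N + D\<close>.\<close>
  have square: "D \<bullet> M - 1/2 * (norm (N - M))\<^sup>2
      = (N + D) \<bullet> M - 1/2 * (norm M)\<^sup>2 - 1/2 * (norm N)\<^sup>2" for D M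
    by (simp add: power2_norm_eq_inner inner_diff inner_add inner_commute field_simps)
  have conj: "conjugate f D = ereal (1/2 * (r_norm r (N + D))\<^sup>2 - 1/2 * (norm N)\<^sup>2)" for D
  proof -
    obtain M0 :: "real^'m^'n" where M0: "rank M0 \<le> r" "(N + D) \<bullet> M0 = (r_norm r (N + D))\<^sup>2"
        "norm M0 = r_norm r (N + D)"
      using low_rank_value_attained[OF r, of "N + D"] by metis
    show ?thesis
    proof (rule conjugate_attained)
      fix M
      show "ereal (D \<bullet> M) - f M \<le> ereal (1/2 * (r_norm r (N + D))\<^sup>2 - 1/2 * (norm N)\<^sup>2)"
      proof (cases "rank M \<le> r")
        case True
        then show ?thesis
          using square[of D M] low_rank_value_le[OF r True, of "N + D"]
          by (simp add: f chi_rank_le_def)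
      qed (simp add: f chi_rank_le_def)
      show "ereal (1/2 * (r_norm r (N + D))\<^sup>2 - 1/2 * (norm N)\<^sup>2) \<le> ereal (D \<bullet> M0) - f M0"
        using square[of D M0] M0 by (simp add: f chi_rank_le_def)
    qed
  qed
  moreover have "conjugate (conjugate f) M
      = ereal (1/2 * (r_dual_norm r M)\<^sup>2 - N \<bullet> M + 1/2 * (norm N)\<^sup>2)" for M
  proof -
    define c where "c = r_dual_norm r M"
    obtain X where X: "r_norm r X \<le> 1" "M \<bullet> X = c" "0 \<le> c"
      using r_dual_norm_attained[OF r, of M] unfolding c_def by metis
    have "conjugate (conjugate f) M = ereal (1/2 * c\<^sup>2 - N \<bullet> M + 1/2 * (norm N)\<^sup>2)"
    proof (rule conjugate_attained)
      fix D
      \<comment> \<open>The Hoelder inequality for the dual norm, then \<open>c y - y\<^sup>2 / 2 \<le> c\<^sup>2 / 2\<close>.\<close>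
      have "0 \<le> (c - r_norm r (N + D))\<^sup>2"
        by simp
      moreover have "N \<bullet> M + M \<bullet> D \<le> c * r_norm r (N + D)"
        using inner_le_dual[OF r, of M "N + D"] by (simp add: c_def inner_add inner_commute)
      ultimately have "N \<bullet> M + M \<bullet> D - 1/2 * (r_norm r (N + D))\<^sup>2 \<le> 1/2 * c\<^sup>2"
        by (simp add: power2_diff)
      then show "ereal (M \<bullet> D) - conjugate f D \<le> ereal (1/2 * c\<^sup>2 - N \<bullet> M + 1/2 * (norm N)\<^sup>2)"
        by (simp add: conj)
    next
      \<comment> \<open>The maximizer is \<open>D = c X - N\<close> with \<open>X\<close> attaining the dual norm.\<close>
      have "r_norm r (c *\<^sub>R X) \<le> c"
        using r_norm_scaleR_le[OF r X(3), of X] mult_left_mono[OF X(1) X(3)] by simp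
      then have "(r_norm r (c *\<^sub>R X))\<^sup>2 \<le> c\<^sup>2"
        by (intro power_mono r_norm_nonneg)
      then show "ereal (1/2 * c\<^sup>2 - N \<bullet> M + 1/2 * (norm N)\<^sup>2)
          \<le> ereal (M \<bullet> (c *\<^sub>R X - N)) - conjugate f (c *\<^sub>R X - N)"
        using X by (simp add: conj inner_diff inner_commute power2_eq_square)
    qed
    then show ?thesis
      by (simp add: c_def)
  qed
  ultimately show ?thesis
    by blast
qed

end
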